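(* Let $\kappa>0$, $\lambda>0$, $\lambda<1+\kappa$, and consider the history-dependent Parrondo games $A$ and $B$ with bias parameter $\varepsilon>0$. If $0<\kappa<\lambda<1$ or $\kappa>\lambda>1$, and if $\gamma\in(0,1)$, then there exists $\varepsilon_0>0$, depending on $\kappa$, $\lambda$, and $\gamma$, such that Parrondo's paradox holds for games $A$, $B$, and $C:=\gamma A+(1-\gamma)B$, that is, $\mu_A(\varepsilon)<0$, $\mu_B(\varepsilon)<0$, and $\mu_C(\varepsilon)>0$, whenever $0<\varepsilon<\varepsilon_0$.
   Context: For $p_0,p_1,p_2,p_3\in(0,1)$ consider the matrix on state space $\Sigma=\{0,1,2,3\}$ $$\boldsymbol{P}(p_0,p_1,p_2,p_3):=\begin{pmatrix}1-p_0&p_0&0&0\\0&0&1-p_1&p_1\\1-p_2&p_2&0&0\\0&0&1-p_3&p_3\end{pmatrix}.$$ (States $0,1,2,3$, in binary $00,01,10,11$, represent loss-loss, loss-win, win-loss, win-win for the two preceding games, the more recent result listed second; $p_i$ is the probability of winning one unit from state $i$, and with probability $1-p_i$ one unit is lost.) This matrix is irreducible and aperiodic; if $\boldsymbol{\pi}=(\pi_0,\pi_1,\pi_2,\pi_3)$ is its unique stationary distribution, the asymptotic mean profit per game played is $\mu:=\sum_{i=0}^3\pi_i(p_i-(1-p_i))$. Let $\varepsilon>0$ be a small bias parameter (small enough that all probabilities below lie in $(0,1)$). Game $A$ has transition matrix $\boldsymbol{P}_A:=\boldsymbol{P}(\tfrac12-\varepsilon,\tfrac12-\varepsilon,\tfrac12-\varepsilon,\tfrac12-\varepsilon)$.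 Game $B$ has transition matrix $\boldsymbol{P}_B:=\boldsymbol{P}(p_0,p_1,p_2,p_3)$ with $p_0:=\frac1{1+\kappa}-\varepsilon$, $p_1=p_2:=\frac{\lambda}{1+\lambda}-\varepsilon$, $p_3:=1-\frac{\lambda}{1+\kappa}-\varepsilon$. The random mixture $C:=\gamma A+(1-\gamma)B$ has transition matrix $\boldsymbol{P}_C:=\gamma\boldsymbol{P}_A+(1-\gamma)\boldsymbol{P}_B$, again of the form $\boldsymbol{P}(\cdot)$. $\mu_A(\varepsilon),\mu_B(\varepsilon),\mu_C(\varepsilon)$ denote the means $\mu$ for $\boldsymbol{P}_A,\boldsymbol{P}_B,\boldsymbol{P}_C$. *)

theory Defs
  imports "HOL-Analysis.Analysis"
begin

text \<open>
  The state space \<open>{0, 1, 2, 3}\<close> is the numeral type \<open>4\<close>, in which \<open>4 = 0\<close>. The library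
  function \<open>vector\<close> starts counting at \<open>1\<close> and would put the entry of state \<open>0\<close> last,
  hence the following constructor, whose entries are listed in the order \<open>0, 1, 2, 3\<close>.
\<close>

definition vec4 :: "'a \<Rightarrow> 'a \<Rightarrow> 'a \<Rightarrow> 'a \<Rightarrow> 'a ^ 4" where
  "vec4 a b c d = (\<chi> i. if i = 0 then a else if i = 1 then b else if i = 2 then c else d)"

definition trans_mat :: "real ^ 4 \<Rightarrow> real ^ 4 ^ 4" where
  "trans_mat p = vec4
     (vec4 (1 - p $ 0) (p $ 0) 0           0)
     (vec4 0           0       (1 - p $ 1) (p $ 1))
     (vec4 (1 - p $ 2) (p $ 2) 0           0)
     (vec4 0           0       (1 - p $ 3) (p $ 3))"

definition is_stationary :: "real ^ 'n ^ 'n \<Rightarrow> real ^ 'n \<Rightarrow> bool" where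
  "is_stationary P \<pi> \<longleftrightarrow> (\<forall>i. 0 \<le> \<pi> $ i) \<and> (\<Sum>i\<in>UNIV. \<pi> $ i) = 1 \<and> \<pi> v* P = \<pi>"

definition stationary :: "real ^ 'n ^ 'n \<Rightarrow> real ^ 'n" where
  "stationary P = (THE \<pi>. is_stationary P \<pi>)"

definition win_probs :: "real ^ 4 ^ 4 \<Rightarrow> real ^ 4" where
  "win_probs P = (THE p. P = trans_mat p)"

definition mean_profit :: "real ^ 4 ^ 4 \<Rightarrow> real" where
  "mean_profit P =
     (\<Sum>i\<in>UNIV. stationary P $ i * (win_probs P $ i - (1 - win_probs P $ i)))"

definition probs_A :: "real \<Rightarrow> real ^ 4" where
  "probs_A \<epsilon> = vec4 (1/2 - \<epsilon>) (1/2 - \<epsilon>) (1/2 - \<epsilon>) (1/2 - \<epsilon>)"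

definition probs_B :: "real \<Rightarrow> real \<Rightarrow> real \<Rightarrow> real ^ 4" where
  "probs_B \<kappa> lam \<epsilon> = vec4
     (1 / (1 + \<kappa>) - \<epsilon>) (lam / (1 + lam) - \<epsilon>) (lam / (1 + lam) - \<epsilon>) (1 - lam / (1 + \<kappa>) - \<epsilon>)"

definition P_A :: "real \<Rightarrow> real ^ 4 ^ 4" where
  "P_A \<epsilon> = trans_mat (probs_A \<epsilon>)"

definition P_B :: "real \<Rightarrow> real \<Rightarrow> real \<Rightarrow> real ^ 4 ^ 4" where
  "P_B \<kappa> lam \<epsilon> = trans_mat (probs_B \<kappa> lam \<epsilon>)"

definition P_C :: "real \<Rightarrow> real \<Rightarrow> real \<Rightarrow> real \<Rightarrow> real ^ 4 ^ 4" where
  "P_C \<gamma> \<kappa> lam \<epsilon> = \<gamma> *\<^sub>R P_A \<epsilon> + (1 - \<gamma>) *\<^sub>R P_B \<kappa> lam \<epsilon>"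

text \<open>The two definite descriptions above are well defined where they are used.\<close>

lemma four_eq_zero: "(4::4) = 0"
  by simp

lemma all4: "(\<forall>i::4. Q i) \<longleftrightarrow> Q 0 \<and> Q 1 \<and> Q 2 \<and> Q 3"
  using forall_4[of Q] unfolding four_eq_zero by blast

lemma sum4: "sum f (UNIV :: 4 set) = f 0 + f 1 + f 2 + (f 3 :: 'a::comm_monoid_add)"
  using sum_4[of f] unfolding four_eq_zero by (simp add: ac_simps)

lemma vec4_nth [simp]:
  "vec4 a b c d $ 0 = a" "vec4 a b c d $ 1 = b" "vec4 a b c d $ 2 = c" "vec4 a b c d $ 3 = d"
  by (simp_all add: vec4_def)

lemma win_probs_trans_mat: "win_probs (trans_mat p) = p"
proof -
  have "q = p" if "trans_mat p = trans_mat q" for q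
  proof -
    have "\<forall>i j. trans_mat p $ i $ j = trans_mat q $ i $ j"
      using that by simp
    then show ?thesis
      by (simp add: all4 trans_mat_def vec_eq_iff)
  qed
  then show ?thesis
    unfolding win_probs_def by (intro the_equality) auto
qed

lemma P_C_eq:
  "P_C \<gamma> \<kappa> lam \<epsilon> = trans_mat (\<gamma> *\<^sub>R probs_A \<epsilon> + (1 - \<gamma>) *\<^sub>R probs_B \<kappa> lam \<epsilon>)"
  by (simp add: P_C_def P_A_def P_B_def vec_eq_iff all4 trans_mat_def algebra_simps)

lemma is_stationary_trans_mat_iff:
  "is_stationary (trans_mat p) \<pi> \<longleftrightarrow>
     0 \<le> \<pi> $ 0 \<and> 0 \<le> \<pi> $ 1 \<and> 0 \<le> \<pi> $ 2 \<and> 0 \<le> \<pi> $ 3 \<and>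
     \<pi> $ 0 + \<pi> $ 1 + \<pi> $ 2 + \<pi> $ 3 = 1 \<and>
     p $ 0 * \<pi> $ 0 = (1 - p $ 2) * \<pi> $ 2 \<and> \<pi> $ 1 = \<pi> $ 2 \<and>
     p $ 1 * \<pi> $ 1 = (1 - p $ 3) * \<pi> $ 3"
  unfolding is_stationary_def
  by (simp add: vec_eq_iff all4 sum4 trans_mat_def vector_matrix_mult_def algebra_simps) argo

lemma ex1_stationary:
  assumes "\<forall>i. 0 < p $ i \<and> p $ i < 1"
  shows "\<exists>!\<pi>. is_stationary (trans_mat p) \<pi>"
proof -
  define a b c d where "a = p $ 0" and "b = p $ 1" and "c = 1 - p $ 2" and "d = 1 - p $ 3"
  have pos: "0 < a" "0 < b" "0 < c" "0 < d"
    using assms by (simp_all add: a_def b_def c_def d_def)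
  define s where "s = c * d + a * d + a * d + a * b"
  have s: "s > 0"
    using pos by (simp add: s_def add_pos_pos)
  define \<pi> where "\<pi> = vec4 (c * d / s) (a * d / s) (a * d / s) (a * b / s)"
  have "c * d / s + a * d / s + a * d / s + a * b / s = s / s"
    by (simp only: s_def add_divide_distrib)
  then have "is_stationary (trans_mat p) \<pi>"
    using pos s
    by (simp add: is_stationary_trans_mat_iff \<pi>_def flip: a_def b_def c_def d_def)
  moreover have "\<rho> = \<pi>" if "is_stationary (trans_mat p) \<rho>" for \<rho>
  proof -
    have e: "\<rho> $ 0 + \<rho> $ 1 + \<rho> $ 2 + \<rho> $ 3 = 1" "a * \<rho> $ 0 = c * \<rho> $ 2"
      "\<rho> $ 1 = \<rho> $ 2" "b * \<rho> $ 1 = d * \<rho> $ 3"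
      using that unfolding is_stationary_trans_mat_iff a_def b_def c_def d_def by blast+
    have "s * \<rho> $ 2 = d * (c * \<rho> $ 2) + a * d * \<rho> $ 1 + a * d * \<rho> $ 2 + a * (b * \<rho> $ 1)"
      by (simp add: s_def e(3) algebra_simps)
    also have "\<dots> = a * d * (\<rho> $ 0 + \<rho> $ 1 + \<rho> $ 2 + \<rho> $ 3)"
      by (simp add: e(4) flip: e(2)) (simp add: algebra_simps)
    finally have "s * \<rho> $ 2 = a * d"
      by (simp only: e(1) mult_1_right)
    then have r2: "\<rho> $ 2 = a * d / s"
      using s by (simp add: field_simps)
    have r0: "\<rho> $ 0 = c * d / s"
      using e(2) pos s by (simp add: r2 field_simps)
    have r3: "\<rho> $ 3 = a * b / s"
      using e(4) pos s by (simp add: e(3) r2 field_simps)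
    show ?thesis
      by (simp add: vec_eq_iff all4 \<pi>_def r0 r2 r3 e(3))
  qed
  ultimately show ?thesis
    by blast
qed

end

theory Submission
  imports Defs
begin

text \<open>
  The mean profit of \<open>P(p\<^sub>0, p\<^sub>1, p\<^sub>2, p\<^sub>3)\<close> has the sign of
  \<open>p\<^sub>0 p\<^sub>1 - (1 - p\<^sub>2) (1 - p\<^sub>3)\<close>. For game \<open>B\<close> this vanishes at zero bias and is strictly
  decreasing in the bias, and likewise for game \<open>A\<close>. For the mixture at zero bias it equals
  \<open>\<gamma> (1 - \<gamma>) (1 - \<lambda>) (\<lambda> - \<kappa>) / (2 (1 + \<kappa>) (1 + \<lambda>)) > 0\<close>, and the bias lowers it by at most
  \<open>4 \<epsilon>\<close>.
\<close>

text \<open>Stationarity makes \<open>p $ 0 * (1 - p $ 3)\<close> times the mean equal to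
  \<open>\<pi> $ 2\<close> times the criterion, and both factors are positive.\<close>

lemma sgn_mean_profit_trans_mat:
  assumes "\<forall>i. 0 < p $ i \<and> p $ i < 1"
  shows "sgn (mean_profit (trans_mat p)) = sgn (p $ 0 * p $ 1 - (1 - p $ 2) * (1 - p $ 3))"
proof -
  define \<pi> where "\<pi> = stationary (trans_mat p)"
  have "is_stationary (trans_mat p) \<pi>"
    unfolding \<pi>_def stationary_def by (rule theI'[OF ex1_stationary[OF assms]])
  then have st: "\<pi> $ 0 + \<pi> $ 1 + \<pi> $ 2 + \<pi> $ 3 = 1" "\<pi> $ 1 = \<pi> $ 2" "0 \<le> \<pi> $ 2"
    "p $ 0 * \<pi> $ 0 = (1 - p $ 2) * \<pi> $ 2" "p $ 1 * \<pi> $ 1 = (1 - p $ 3) * \<pi> $ 3"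
    unfolding is_stationary_trans_mat_iff by blast+
  have pos: "0 < p $ 0" "0 < 1 - p $ 3"
    using assms by simp_all
  \<comment> \<open>Otherwise the balance equations would make all entries vanish, against total
    mass 1.\<close>
  have "\<pi> $ 2 \<noteq> 0"
    using st pos by auto
  with st have \<pi>2: "0 < \<pi> $ 2"
    by simp
  \<comment> \<open>By the balance equations the win rate is \<open>\<pi> $ 2 + \<pi> $ 3\<close>;
    subtract the total mass and use \<open>\<pi> $ 1 = \<pi> $ 2\<close>.\<close>
  have \<mu>: "mean_profit (trans_mat p) = \<pi> $ 3 - \<pi> $ 0"
    using st(2,4,5)
    by (simp add: mean_profit_def win_probs_trans_mat sum4 algebra_simps flip: \<pi>_def)
  have "(p $ 0 * (1 - p $ 3)) * mean_profit (trans_mat p)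
      = p $ 0 * ((1 - p $ 3) * \<pi> $ 3) - (1 - p $ 3) * (p $ 0 * \<pi> $ 0)"
    by (simp add: \<mu> algebra_simps)
  also have "\<dots> = \<pi> $ 2 * (p $ 0 * p $ 1 - (1 - p $ 2) * (1 - p $ 3))"
    by (simp add: st(2,4) flip: st(5)) (simp add: algebra_simps)
  finally have "sgn ((p $ 0 * (1 - p $ 3)) * mean_profit (trans_mat p))
      = sgn (\<pi> $ 2 * (p $ 0 * p $ 1 - (1 - p $ 2) * (1 - p $ 3)))"
    by simp
  with pos \<pi>2 show ?thesis
    by (simp add: sgn_mult)
qed

lemma mean_profit_pos_iff:
  assumes "\<forall>i. 0 < p $ i \<and> p $ i < 1"
  shows "0 < mean_profit (trans_mat p) \<longleftrightarrow> (1 - p $ 2) * (1 - p $ 3) < p $ 0 * p $ 1"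
  using sgn_mean_profit_trans_mat[OF assms] by (metis diff_gt_0_iff_gt sgn_greater)

lemma mean_profit_neg_iff:
  assumes "\<forall>i. 0 < p $ i \<and> p $ i < 1"
  shows "mean_profit (trans_mat p) < 0 \<longleftrightarrow> p $ 0 * p $ 1 < (1 - p $ 2) * (1 - p $ 3)"
  using sgn_mean_profit_trans_mat[OF assms] by (metis diff_less_0_iff_less sgn_less)

theorem corollary5:
  fixes \<kappa> lam \<gamma> :: real
  assumes "\<kappa> > 0" and "lam > 0" and "lam < 1 + \<kappa>"
    and "(0 < \<kappa> \<and> \<kappa> < lam \<and> lam < 1) \<or> (\<kappa> > lam \<and> lam > 1)"
    and "0 < \<gamma>" and "\<gamma> < 1"
  shows "\<exists>\<epsilon>\<^sub>0>0. \<forall>\<epsilon>. 0 < \<epsilon> \<and> \<epsilon> < \<epsilon>\<^sub>0 \<longrightarrow>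
           (\<forall>i. probs_A \<epsilon> $ i \<in> {0<..<1} \<and> probs_B \<kappa> lam \<epsilon> $ i \<in> {0<..<1}) \<and>
           mean_profit (P_A \<epsilon>) < 0 \<and>
           mean_profit (P_B \<kappa> lam \<epsilon>) < 0 \<and>
           mean_profit (P_C \<gamma> \<kappa> lam \<epsilon>) > 0"
proof -
  \<comment> \<open>For game B at zero bias, \<open>a\<close> and \<open>b\<close> are the winning
    probabilities in state 0 and in states 1, 2; \<open>c\<close> and \<open>d\<close> are the
    losing probabilities in states 1, 2 and in state 3.\<close>
  define a b c d where "a = 1 / (1 + \<kappa>)" and "b = lam / (1 + lam)"
    and "c = 1 / (1 + lam)" and "d = lam / (1 + \<kappa>)"
  have pos: "0 < a" "0 < b" "0 < c" "0 < d"
    using assms(1,2) by (simp_all add: a_def b_def c_def d_def)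
  have lt1: "a < 1" "b < 1" "d < 1"
    using assms(1-3) by (simp_all add: a_def b_def d_def)
  have c: "c = 1 - b"
    using assms(2) by (simp add: b_def c_def field_simps)
  \<comment> \<open>This is fairness of game B at zero bias.\<close>
  have ab_cd: "a * b = c * d"
    by (simp add: a_def b_def c_def d_def)
  have "a + b - c - d = (1 - lam) * (lam - \<kappa>) / ((1 + \<kappa>) * (1 + lam))"
    using assms(1,2) by (simp add: a_def b_def c_def d_def divide_simps) (simp add: algebra_simps)
  \<comment> \<open>\<open>1 - lam\<close> and \<open>lam - \<kappa>\<close> are both positive in
    the first parameter region and both negative in the second.\<close>
  also have "\<dots> > 0"
    using assms(1,2,4) by (auto simp: zero_less_divide_iff zero_less_mult_iff)
  finally have gap: "a + b - c - d > 0" .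
  define N where "N = \<gamma> * (1 - \<gamma>) / 2 * (a + b - c - d)"
  have N: "N > 0"
    using assms(5,6) gap by (simp add: N_def)
  \<comment> \<open>The first four bounds keep the probabilities of A and B inside (0,1);
    \<open>N / 4\<close> keeps the loss due to the bias below \<open>N\<close>.\<close>
  define \<epsilon>\<^sub>0 where "\<epsilon>\<^sub>0 = Min {1/2, a, b, 1 - d, N / 4}"
  have "\<epsilon>\<^sub>0 > 0"
    using pos lt1 N by (simp add: \<epsilon>\<^sub>0_def)
  moreover have "(\<forall>i. probs_A \<epsilon> $ i \<in> {0<..<1} \<and> probs_B \<kappa> lam \<epsilon> $ i \<in> {0<..<1}) \<and>
           mean_profit (P_A \<epsilon>) < 0 \<and>
           mean_profit (P_B \<kappa> lam \<epsilon>) < 0 \<and>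
           mean_profit (P_C \<gamma> \<kappa> lam \<epsilon>) > 0" if "0 < \<epsilon>" "\<epsilon> < \<epsilon>\<^sub>0" for \<epsilon>
  proof -
    have small: "\<epsilon> < 1/2" "\<epsilon> < a" "\<epsilon> < b" "\<epsilon> < 1 - d" "4 * \<epsilon> < N"
      using that(2) by (simp_all add: \<epsilon>\<^sub>0_def)
    define q where "q = \<gamma> *\<^sub>R probs_A \<epsilon> + (1 - \<gamma>) *\<^sub>R probs_B \<kappa> lam \<epsilon>"
    have B: "probs_B \<kappa> lam \<epsilon> = vec4 (a - \<epsilon>) (b - \<epsilon>) (b - \<epsilon>) (1 - d - \<epsilon>)"
      by (simp add: probs_B_def a_def b_def d_def)
    have pA: "\<forall>i. 0 < probs_A \<epsilon> $ i \<and> probs_A \<epsilon> $ i < 1"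
      using that(1) small by (simp add: all4 probs_A_def)
    have pB: "\<forall>i. 0 < probs_B \<kappa> lam \<epsilon> $ i \<and> probs_B \<kappa> lam \<epsilon> $ i < 1"
      using that(1) small pos lt1 by (simp add: all4 B)
    have pC: "\<forall>i. 0 < q $ i \<and> q $ i < 1"
    proof
      fix i
      have "q $ i = \<gamma> * probs_A \<epsilon> $ i + (1 - \<gamma>) * probs_B \<kappa> lam \<epsilon> $ i"
        by (simp add: q_def)
      then show "0 < q $ i \<and> q $ i < 1"
        using pA pB assms(5,6) by (auto intro: add_pos_pos convex_bound_lt)
    qed
    have "mean_profit (P_A \<epsilon>) < 0"
      unfolding P_A_def mean_profit_neg_iff[OF pA] using that(1)
      by (simp add: probs_A_def algebra_simps)
    moreover have "mean_profit (P_B \<kappa> lam \<epsilon>) < 0"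
    proof -
      have "(a - \<epsilon>) * (b - \<epsilon>) < a * b"
        using that(1) small by (intro mult_strict_mono) auto
      also have "\<dots> < (c + \<epsilon>) * (d + \<epsilon>)"
        unfolding ab_cd using that(1) pos by (intro mult_strict_mono) auto
      also have "\<dots> = (1 - (b - \<epsilon>)) * (1 - (1 - d - \<epsilon>))"
        by (simp add: c algebra_simps)
      finally show ?thesis
        unfolding P_B_def mean_profit_neg_iff[OF pB] by (simp add: B)
    qed
    moreover have "mean_profit (P_C \<gamma> \<kappa> lam \<epsilon>) > 0"
    proof -
      define a' b' c' d' where "a' = \<gamma> / 2 + (1 - \<gamma>) * a" and "b' = \<gamma> / 2 + (1 - \<gamma>) * b"
        and "c' = \<gamma> / 2 + (1 - \<gamma>) * c" and "d' = \<gamma> / 2 + (1 - \<gamma>) * d"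
      have q: "q $ 0 = a' - \<epsilon>" "q $ 1 = b' - \<epsilon>" "1 - q $ 2 = c' + \<epsilon>" "1 - q $ 3 = d' + \<epsilon>"
        by (simp_all add: q_def B probs_A_def a'_def b'_def c'_def d'_def c algebra_simps)
      \<comment> \<open>The squares of \<open>\<gamma> / 2\<close> cancel, the cross terms give
        \<open>N\<close>, and the last term vanishes by fairness of B.\<close>
      have "a' * b' - c' * d' = N + (1 - \<gamma>)\<^sup>2 * (a * b - c * d)"
        by (simp add: a'_def b'_def c'_def d'_def N_def field_simps power2_eq_square)
      then have N': "a' * b' - c' * d' = N"
        by (simp add: ab_cd)
      \<comment> \<open>The quadratic terms in \<epsilon> cancel. The coefficient
        \<open>a' + b' + c' + d'\<close> is unchanged by the bias shifts, so it is a sum of four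
        probabilities of C.\<close>
      have "q $ 0 * q $ 1 - (1 - q $ 2) * (1 - q $ 3)
          = N - (q $ 0 + q $ 1 + (1 - q $ 2) + (1 - q $ 3)) * \<epsilon>"
        unfolding q by (simp add: algebra_simps flip: N')
      moreover have "q $ 0 + q $ 1 + (1 - q $ 2) + (1 - q $ 3) < 4"
        using pC[rule_format, of 0] pC[rule_format, of 1] pC[rule_format, of 2]
          pC[rule_format, of 3] by simp
      then have "(q $ 0 + q $ 1 + (1 - q $ 2) + (1 - q $ 3)) * \<epsilon> < 4 * \<epsilon>"
        using that(1) by (rule mult_strict_right_mono)
      ultimately show ?thesis
        unfolding P_C_eq q_def[symmetric] mean_profit_pos_iff[OF pC] using small(5) by linarith
    qed
    ultimately show ?thesis
      using pA pB by simp
  qed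
  ultimately show ?thesis
    by blast
qed

end
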